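(* Let $\varrho\colon \mathrm{B}_{\mathrm b}\to[0,1]$ be a default risk measure with $\varrho(X)=\varrho(\mathbf 1_{\{X>0\}})$ for all $X\in \mathrm{B}_{\mathrm b}$, and let $c(A):=\varrho(\mathbf 1_A)$ for all $A\in\mathcal F$. Then the following statements are equivalent. \begin{enumerate} \item[(i)] For every sequence $(X_n)_{n\in\mathbb{N}}\subset \mathrm{B}_{\mathrm b}$ with $X_n\searrow 0$ as $n\to\infty$ and all $\varepsilon>0$, $\lim_{n\to\infty}\varrho(X_n-\varepsilon)=0$. \item[(ii)] For every sequence $(A_n)_{n\in\mathbb{N}}\subset\mathcal F$ with $A_{n+1}\subset A_n$ for all $n\in\mathbb{N}$ and $\bigcap_{n\in\mathbb{N}}A_n=\emptyset$, $\lim_{n\to\infty}\varrho(\mathbf 1_{A_n})=0$. \item[(iii)] For every sequence $(X_n)_{n\in\mathbb{N}}\subset \mathrm{B}_{\mathrm b}$ with $X_n\searrow 0$ as $n\to\infty$, $\lim_{n\to\infty}\int X_n\,\mathrm{d}c=0$. \end{enumerate} If $\varrho$ is additionally submodular, either of these conditions implies that there exists a nonempty set $\mathcal P$ of (countably additive) probability measures on $(\Omega,\mathcal F)$ with \[ \varrho(X)=\max_{\mathbb{Q}\in\mathcal P}\mathbb{Q}(X>0)\quad\text{for all }X\in \mathrm{B}_{\mathrm b}. \]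
   Context: $(\Omega,\mathcal F)$ is a measurable space ($\Omega\neq\emptyset$) and $\mathrm{B}_{\mathrm b}$ is the space of all bounded measurable functions $\Omega\to\mathbb{R}$, ordered pointwise; $X\vee Y$, $X\wedge Y$ are pointwise maximum and minimum; real constants are identified with constant functions. $X_n\searrow X$ means $X_n\ge X_{n+1}$ for all $n$ and $X(\omega)=\lim_n X_n(\omega)$ for all $\omega\in\Omega$. A map $\varrho\colon \mathrm{B}_{\mathrm b}\to[0,1]$ is a default risk measure if (i) $\varrho(X)\le\varrho(Y)$ whenever $X\le Y$, and (ii) $\varrho(0)=0$ and $\varrho(m)=1$ for all real $m>0$. It is submodular if $\varrho(X\wedge Y)+\varrho(X\vee Y)\le\varrho(X)+\varrho(Y)$ for all $X,Y\in \mathrm{B}_{\mathrm b}$. The set function $c$ is a capacity, i.e. $c\colon\mathcal F\to[0,1]$ with $c(\emptyset)=0$, $c(\Omega)=1$ and $c(A)\le c(B)$ for $A\subset B$; the Choquet integral of $X\in \mathrm{B}_{\mathrm b}$ with respect to $c$ is \[ \int X\,\mathrm{d}c:=\int_{-\infty}^0\big(c(\{X>s\})-1\big)\,\mathrm{d}s+\int_0^\infty c(\{X>s\})\,\mathrm{d}s. \] *)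

theory Defs
  imports "HOL-Probability.Probability"
begin

text \<open>
  A measurable space is represented by a value \<open>M :: 'a measure\<close>, of which only \<open>space M\<close> and
  \<open>sets M\<close> are used. Functions on it are total functions on the type \<open>'a\<close>; every condition below
  is restricted to \<open>space M\<close>, and the monotonicity of a default risk measure makes its value
  independent of the values of its argument outside \<open>space M\<close>.
\<close>

definition bounded_measurable :: "'a measure \<Rightarrow> ('a \<Rightarrow> real) set"
  where "bounded_measurable M =
    {X. X \<in> borel_measurable M \<and> (\<exists>C. \<forall>\<omega>\<in>space M. \<bar>X \<omega>\<bar> \<le> C)}"

definition default_risk_measure :: "'a measure \<Rightarrow> (('a \<Rightarrow> real) \<Rightarrow> real) \<Rightarrow> bool"
  where "default_risk_measure M \<rho> \<longleftrightarrow>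
    (\<forall>X\<in>bounded_measurable M. \<rho> X \<in> {0..1}) \<and>
    (\<forall>X\<in>bounded_measurable M. \<forall>Y\<in>bounded_measurable M.
       (\<forall>\<omega>\<in>space M. X \<omega> \<le> Y \<omega>) \<longrightarrow> \<rho> X \<le> \<rho> Y) \<and>
    \<rho> (\<lambda>_. 0) = 0 \<and> (\<forall>m>0. \<rho> (\<lambda>_. m) = 1)"

definition submodular_risk :: "'a measure \<Rightarrow> (('a \<Rightarrow> real) \<Rightarrow> real) \<Rightarrow> bool"
  where "submodular_risk M \<rho> \<longleftrightarrow>
    (\<forall>X\<in>bounded_measurable M. \<forall>Y\<in>bounded_measurable M.
       \<rho> (\<lambda>\<omega>. min (X \<omega>) (Y \<omega>)) + \<rho> (\<lambda>\<omega>. max (X \<omega>) (Y \<omega>)) \<le> \<rho> X + \<rho> Y)"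

definition decreases_to :: "'a measure \<Rightarrow> (nat \<Rightarrow> 'a \<Rightarrow> real) \<Rightarrow> ('a \<Rightarrow> real) \<Rightarrow> bool"
  where "decreases_to M Xs X \<longleftrightarrow>
    (\<forall>n. \<forall>\<omega>\<in>space M. Xs (Suc n) \<omega> \<le> Xs n \<omega>) \<and>
    (\<forall>\<omega>\<in>space M. (\<lambda>n. Xs n \<omega>) \<longlonglongrightarrow> X \<omega>)"

text \<open>
  For a capacity \<open>c\<close> and a bounded measurable \<open>X\<close>, both integrands are monotone in \<open>s\<close> and vanish
  outside a bounded interval, so the Lebesgue integrals below exist and agree with the
  (improper) Riemann integrals.
\<close>

definition choquet_integral :: "'a measure \<Rightarrow> ('a set \<Rightarrow> real) \<Rightarrow> ('a \<Rightarrow> real) \<Rightarrow> real"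
  where "choquet_integral M c X =
    (LBINT s:{..0}. c {\<omega>\<in>space M. X \<omega> > s} - 1) +
    (LBINT s:{0..}. c {\<omega>\<in>space M. X \<omega> > s})"

end

theory Submission
  imports Defs
begin

text \<open>
  The equivalences reduce to the level sets \<open>{X\<^sub>n > s}\<close>, which decrease to the empty set for \<open>s > 0\<close>
  when \<open>X\<^sub>n\<close> decreases to \<open>0\<close>; condition (iii) then follows by dominated convergence.

  For the representation, a set \<open>A\<close> turns a submodular capacity \<open>c\<close> into the submodular capacity
  \<open>B \<mapsto> c (B \<inter> A) + c (B \<union> A) - c A\<close>, which lies below \<open>c\<close>, agrees with \<open>c\<close> at \<open>A\<close> and splits every
  \<open>B\<close> additively along \<open>A\<close>. A minimal submodular capacity, which exists by Zorn's lemma, is fixed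
  by all these operations and hence additive. Being dominated by \<open>c\<close>, it inherits continuity at the
  empty set and is therefore countably additive.
\<close>

section \<open>Submodular capacities\<close>

locale capacity = algebra \<Omega> F for \<Omega> :: "'a set" and F +
  fixes c :: "'a set \<Rightarrow> real"
  assumes cap_empty: "c {} = 0"
    and cap_space: "c \<Omega> = 1"
    and cap_mono: "\<lbrakk>A \<in> F; B \<in> F; A \<subseteq> B\<rbrakk> \<Longrightarrow> c A \<le> c B"
begin

lemma cap_nonneg: "A \<in> F \<Longrightarrow> 0 \<le> c A"
  using cap_mono[of "{}" A] cap_empty by auto

lemma cap_le_1: "A \<in> F \<Longrightarrow> c A \<le> 1"
  using cap_mono[of A \<Omega>] cap_space sets_into_space by auto

end

locale submodular_capacity = capacity +
  assumes cap_submodular: "\<lbrakk>A \<in> F; B \<in> F\<rbrakk> \<Longrightarrow> c (A \<inter> B) + c (A \<union> B) \<le> c A + c B"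

text \<open>The value \<open>0\<close> outside \<open>F\<close> makes the pointwise order on \<open>F\<close> antisymmetric, as Zorn's lemma needs.\<close>

definition modularize :: "'a set set \<Rightarrow> ('a set \<Rightarrow> real) \<Rightarrow> 'a set \<Rightarrow> 'a set \<Rightarrow> real"
  where "modularize F c A B = (if B \<in> F then c (B \<inter> A) + c (B \<union> A) - c A else 0)"

context submodular_capacity
begin

lemma modularize_le: "\<lbrakk>A \<in> F; B \<in> F\<rbrakk> \<Longrightarrow> modularize F c A B \<le> c B"
  using cap_submodular[of B A] by (auto simp: modularize_def)

lemma modularize_self: "A \<in> F \<Longrightarrow> modularize F c A A = c A"
  by (simp add: modularize_def)

text \<open>On subsets of \<open>A\<close> the new set function is \<open>c\<close> itself, and on
  sets disjoint from \<open>A\<close> it is the increment of \<open>c\<close> over \<open>A\<close>.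
  Its value at \<open>B\<close> is by definition the sum of these two contributions.\<close>

lemma modularize_split:
  assumes "A \<in> F" "B \<in> F"
  shows "modularize F c A B = modularize F c A (B \<inter> A) + modularize F c A (B - A)"
proof -
  have "B \<inter> A \<inter> A = B \<inter> A" "B \<inter> A \<union> A = A" "(B - A) \<inter> A = {}" "B - A \<union> A = B \<union> A"
    by auto
  with assms show ?thesis
    by (auto simp: modularize_def cap_empty)
qed

text \<open>Intersecting with \<open>A\<close> and joining with \<open>A\<close> are both monotone
  and commute with \<inter> and \<union>, so each of the two summands inherits monotonicity and
  submodularity from \<open>c\<close>. The constant \<open>c A\<close> only normalises the value at
  the empty set.\<close>

lemma submodular_capacity_modularize:
  assumes A: "A \<in> F"
  shows "submodular_capacity \<Omega> F (modularize F c A)"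
proof
  show "modularize F c A {} = 0"
    by (simp add: modularize_def cap_empty)
  have "\<Omega> \<inter> A = A" "\<Omega> \<union> A = \<Omega>"
    using A sets_into_space by auto
  then show "modularize F c A \<Omega> = 1"
    by (simp add: modularize_def cap_space)
next
  fix B C assume BC: "B \<in> F" "C \<in> F" "B \<subseteq> C"
  have "c (B \<inter> A) \<le> c (C \<inter> A)" "c (B \<union> A) \<le> c (C \<union> A)"
    using A BC by (auto intro!: cap_mono)
  then show "modularize F c A B \<le> modularize F c A C"
    using BC by (simp add: modularize_def)
next
  fix B C assume BC: "B \<in> F" "C \<in> F"
  have "(B \<inter> A) \<inter> (C \<inter> A) = (B \<inter> C) \<inter> A" "(B \<inter> A) \<union> (C \<inter> A) = (B \<union> C) \<inter> A"
    "(B \<union> A) \<inter> (C \<union> A) = (B \<inter> C) \<union> A" "(B \<union> A) \<union> (C \<union> A) = (B \<union> C) \<union> A"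
    by auto
  then have "c ((B \<inter> C) \<inter> A) + c ((B \<union> C) \<inter> A) \<le> c (B \<inter> A) + c (C \<inter> A)"
    "c ((B \<inter> C) \<union> A) + c ((B \<union> C) \<union> A) \<le> c (B \<union> A) + c (C \<union> A)"
    using cap_submodular[of "B \<inter> A" "C \<inter> A"] cap_submodular[of "B \<union> A" "C \<union> A"] A BC by auto
  then show "modularize F c A (B \<inter> C) + modularize F c A (B \<union> C)
    \<le> modularize F c A B + modularize F c A C"
    using BC Int[OF BC] Un[OF BC] by (simp add: modularize_def)
qed

end

section \<open>Minimal submodular capacities and finite additivity\<close>

text \<open>This supplies the bounds of chains for Zorn's lemma. The delicate point is
  submodularity, where the two infima on the right must be taken independently; in a chain the
  smaller of two members \<open>d\<close> and \<open>e\<close> bounds both terms at once.\<close>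

lemma submodular_capacity_INF_chain:
  assumes ne: "D \<noteq> {}"
    and sub: "\<And>d. d \<in> D \<Longrightarrow> submodular_capacity \<Omega> F d"
    and chain: "\<And>d e. \<lbrakk>d \<in> D; e \<in> D\<rbrakk> \<Longrightarrow> (\<forall>B\<in>F. d B \<le> e B) \<or> (\<forall>B\<in>F. e B \<le> d B)"
  shows "submodular_capacity \<Omega> F (\<lambda>B. INF d\<in>D. d B)"
proof -
  obtain d0 where d0: "d0 \<in> D"
    using ne by auto
  interpret d0: submodular_capacity \<Omega> F d0
    by (rule sub[OF d0])
  have bdd: "bdd_below ((\<lambda>d. d B) ` D)" if "B \<in> F" for B
    using that capacity.cap_nonneg[OF submodular_capacity.axioms(1)[OF sub]]
    by (auto intro!: bdd_belowI2[where m = 0])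
  have lower: "(INF d\<in>D. d B) \<le> d B" if "B \<in> F" "d \<in> D" for B d
    using that by (auto intro!: cINF_lower bdd)
  show ?thesis
  proof
    have "(\<lambda>d. d {}) ` D = (\<lambda>_. 0) ` D" "(\<lambda>d. d \<Omega>) ` D = (\<lambda>_. 1) ` D"
      using capacity.cap_empty[OF submodular_capacity.axioms(1)[OF sub]]
        capacity.cap_space[OF submodular_capacity.axioms(1)[OF sub]]
      by (auto intro!: image_cong)
    then show "(INF d\<in>D. d {}) = 0" "(INF d\<in>D. d \<Omega>) = 1"
      using ne by simp_all
  next
    fix A B assume AB: "A \<in> F" "B \<in> F" "A \<subseteq> B"
    show "(INF d\<in>D. d A) \<le> (INF d\<in>D. d B)"
      using AB capacity.cap_mono[OF submodular_capacity.axioms(1)[OF sub]]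
      by (intro cINF_mono[OF ne] bdd) blast+
  next
    fix A B assume AB: "A \<in> F" "B \<in> F"
    let ?m = "\<lambda>B. INF d\<in>D. d B"
    have *: "?m (A \<inter> B) + ?m (A \<union> B) \<le> d A + e B" if de: "d \<in> D" "e \<in> D" for d e
    proof -
      obtain f where f: "f \<in> D" "f A \<le> d A" "f B \<le> e B"
        using chain[OF de] de AB by blast
      have "?m (A \<inter> B) + ?m (A \<union> B) \<le> f (A \<inter> B) + f (A \<union> B)"
        using AB f by (intro add_mono lower) auto
      also have "\<dots> \<le> f A + f B"
        using submodular_capacity.cap_submodular[OF sub[OF f(1)]] AB by auto
      finally show ?thesis using f by simp
    qed
    \<comment> \<open>The infimum over \<open>d\<close> is taken first, with \<open>e\<close> fixed,
      and the infimum over \<open>e\<close> afterwards.\<close>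
    have "?m (A \<inter> B) + ?m (A \<union> B) - e B \<le> ?m A" if "e \<in> D" for e
      using * that by (intro cINF_greatest[OF ne]) (simp add: algebra_simps)
    then have "?m (A \<inter> B) + ?m (A \<union> B) - ?m A \<le> ?m B"
      by (intro cINF_greatest[OF ne]) (simp add: algebra_simps)
    then show "?m (A \<inter> B) + ?m (A \<union> B) \<le> ?m A + ?m B"
      by simp
  qed
qed

text \<open>A finitely additive analogue of the Hahn-Banach theorem: \<open>c\<close> is the upper
  envelope of the additive capacities below it, and the supremum is attained at each set. Minimising
  below \<open>modularize F c A\<close> instead of \<open>c\<close> is what preserves the value at
  \<open>A\<close>.\<close>

theorem (in submodular_capacity) ex_additive_capacity_below:
  assumes A: "A \<in> F"
  obtains q where "capacity \<Omega> F q" "additive F q" "\<And>B. B \<in> F \<Longrightarrow> q B \<le> c B" "q A = c A"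
proof -
  let ?c = "modularize F c A"
  define S where "S = {d. submodular_capacity \<Omega> F d \<and> (\<forall>B\<in>F. d B \<le> ?c B) \<and> (\<forall>B. B \<notin> F \<longrightarrow> d B = 0)}"
  \<comment> \<open>The order is reversed, so that the maximal element given by Zorn's lemma is a
    minimal capacity.\<close>
  define P where "P = (\<lambda>d e :: 'a set \<Rightarrow> real. \<forall>B\<in>F. e B \<le> d B)"
  have cS: "?c \<in> S"
    using submodular_capacity_modularize[OF A] by (auto simp: S_def modularize_def)
  have "\<exists>m\<in>S. \<forall>d\<in>S. P m d \<longrightarrow> d = m"
  proof (rule predicate_Zorn)
    show "partial_order_on S (relation_of P S)"
    proof (rule partial_order_on_relation_ofI)
      fix d e assume "d \<in> S" "e \<in> S" "P d e" "P e d"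
      then show "d = e"
        by (intro ext) (metis (mono_tags, lifting) P_def S_def mem_Collect_eq order_antisym)
    qed (force simp: P_def)+
  next
    fix D assume D: "D \<in> Chains (relation_of P S)"
    then have DS: "D \<subseteq> S"
      by (rule Chains_relation_of)
    show "\<exists>u\<in>S. \<forall>d\<in>D. P d u"
    proof (cases "D = {}")
      case True
      then show ?thesis using cS by auto
    next
      case False
      have chain: "(\<forall>B\<in>F. d B \<le> e B) \<or> (\<forall>B\<in>F. e B \<le> d B)" if "d \<in> D" "e \<in> D" for d e
        using that D by (auto simp: Chains_def relation_of_def P_def)
      have sub: "submodular_capacity \<Omega> F d" if "d \<in> D" for d
        using that DS by (auto simp: S_def)
      let ?m = "\<lambda>B. INF d\<in>D. d B"
      have m: "submodular_capacity \<Omega> F ?m"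
        by (rule submodular_capacity_INF_chain[OF False sub chain])
      have low: "?m B \<le> d B" if "B \<in> F" "d \<in> D" for B d
        using that capacity.cap_nonneg[OF submodular_capacity.axioms(1)[OF sub]]
        by (auto intro!: cINF_lower bdd_belowI2[where m = 0])
      have "?m B \<le> ?c B" if "B \<in> F" for B
        using low[OF that] False DS that unfolding S_def by fastforce
      moreover have "?m B = 0" if "B \<notin> F" for B
      proof -
        have "(\<lambda>d. d B) ` D = (\<lambda>_. 0) ` D"
          using that DS by (intro image_cong) (auto simp: S_def)
        then show ?thesis
          using False by simp
      qed
      ultimately have "?m \<in> S"
        using m by (simp add: S_def)
      then show ?thesis
        using low by (intro bexI[of _ ?m]) (auto simp: P_def)
    qed
  qed
  then obtain q where qS: "q \<in> S" and min: "\<And>d. d \<in> S \<Longrightarrow> P q d \<Longrightarrow> d = q"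
    by auto
  interpret q: submodular_capacity \<Omega> F q
    using qS by (simp add: S_def)
  have q_le: "q B \<le> ?c B" if "B \<in> F" for B
    using qS that by (simp add: S_def)
  \<comment> \<open>Modularizing \<open>q\<close> stays in \<open>S\<close> and can only decrease
    it, so minimality forces equality.\<close>
  have fixed: "modularize F q B = q" if B: "B \<in> F" for B
  proof (rule min)
    show "P q (modularize F q B)"
      using q.modularize_le[OF B] by (simp add: P_def)
    show "modularize F q B \<in> S"
      using q.modularize_le[OF B] q_le q.submodular_capacity_modularize[OF B]
      by (auto simp: S_def modularize_def[of F q] intro: order_trans)
  qed
  have add: "additive F q"
  proof (unfold additive_def, intro ballI impI)
    fix B C assume BC: "B \<in> F" "C \<in> F" "B \<inter> C = {}"
    then have "(B \<union> C) \<inter> B = B" "(B \<union> C) - B = C"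
      by auto
    then show "q (B \<union> C) = q B + q C"
      using q.modularize_split[of B "B \<union> C"] BC Un[OF BC(1,2)] by (simp add: fixed)
  qed
  have "q B \<le> c B" if "B \<in> F" for B
    using q_le[OF that] modularize_le[OF A that] by simp
  \<comment> \<open>Both \<open>q\<close> and \<open>?c\<close> have values at \<open>A\<close> and
    its complement that sum to 1. As \<open>q\<close> lies below \<open>?c\<close> at both sets, the
    values coincide, and \<open>?c A = c A\<close>.\<close>
  moreover have "q A = c A"
  proof -
    have "A \<union> (\<Omega> - A) = \<Omega>" "\<Omega> \<inter> A = A"
      using A sets_into_space by auto
    then have "q A + q (\<Omega> - A) = 1" "?c A + ?c (\<Omega> - A) = 1"
      using additiveD[OF add, of A "\<Omega> - A"] modularize_split[OF A top] A
        capacity.cap_space[OF submodular_capacity.axioms(1)[OF submodular_capacity_modularize[OF A]]]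
        q.cap_space by auto
    then show ?thesis
      using q_le[of A] q_le[OF compl_sets[OF A]] modularize_self[OF A] A by auto
  qed
  ultimately show ?thesis
    using that add q.capacity_axioms by blast
qed

section \<open>From finite to countable additivity\<close>

definition continuous_at_empty :: "'a set set \<Rightarrow> ('a set \<Rightarrow> real) \<Rightarrow> bool"
  where "continuous_at_empty F c \<longleftrightarrow>
    (\<forall>A. (\<forall>n::nat. A n \<in> F) \<and> (\<forall>n. A (Suc n) \<subseteq> A n) \<and> (\<Inter>n. A n) = {} \<longrightarrow> (\<lambda>n. c (A n)) \<longlonglongrightarrow> 0)"

text \<open>The additive \<open>q\<close> is squeezed between 0 and \<open>c\<close>, hence
  continuous at the empty set; for a finite additive set function this amounts to countable
  additivity.\<close>

theorem ex_prob_space_below: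
  assumes "submodular_capacity (space M) (sets M) c"
    and cont: "continuous_at_empty (sets M) c"
    and A: "A \<in> sets M"
  obtains Q where "prob_space Q" "sets Q = sets M"
    "\<And>B. B \<in> sets M \<Longrightarrow> measure Q B \<le> c B" "measure Q A = c A"
proof -
  interpret submodular_capacity "space M" "sets M" c by fact
  obtain q where q: "capacity (space M) (sets M) q" "additive (sets M) q"
    and q_le: "\<And>B. B \<in> sets M \<Longrightarrow> q B \<le> c B" and qA: "q A = c A"
    using ex_additive_capacity_below[OF A] by metis
  interpret q: capacity "space M" "sets M" q by (rule q)
  let ?q = "\<lambda>B. ennreal (q B)"
  have pos: "positive (sets M) ?q"
    by (simp add: positive_def q.cap_empty)
  have "countably_additive (sets M) ?q"
  proof (rule sets.empty_continuous_imp_countably_additive[OF pos])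
    show "additive (sets M) ?q"
      using q.cap_nonneg q(2) by (auto simp: additive_def ennreal_plus[symmetric] simp del: ennreal_plus)
    show "\<forall>B\<in>sets M. ?q B \<noteq> \<infinity>" by simp
    fix B :: "nat \<Rightarrow> 'a set"
    assume B: "range B \<subseteq> sets M" "decseq B" "(\<Inter>i. B i) = {}"
    then have "(\<lambda>i. c (B i)) \<longlonglongrightarrow> 0"
      using cont by (auto simp: continuous_at_empty_def decseq_Suc_iff image_subset_iff)
    then have "(\<lambda>i. q (B i)) \<longlonglongrightarrow> 0"
    proof (rule tendsto_sandwich[OF _ _ tendsto_const, rotated 2])
      have "B i \<in> sets M" for i
        using B by auto
      then show "\<forall>\<^sub>F i in sequentially. 0 \<le> q (B i)" "\<forall>\<^sub>F i in sequentially. q (B i) \<le> c (B i)"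
        using q_le q.cap_nonneg by simp_all
    qed
    then show "(\<lambda>i. ?q (B i)) \<longlonglongrightarrow> 0"
      using tendsto_ennrealI by fastforce
  qed
  then have em: "emeasure (measure_of (space M) (sets M) ?q) B = ?q B" if "B \<in> sets M" for B
    using that pos by (intro emeasure_measure_of_sigma) (auto intro: sets.sigma_algebra_axioms)
  let ?Q = "measure_of (space M) (sets M) ?q"
  have meas: "measure ?Q B = q B" if "B \<in> sets M" for B
    using em[OF that] q.cap_nonneg[OF that] by (simp add: measure_def)
  show ?thesis
  proof (rule that[of ?Q])
    show "prob_space ?Q"
      by (rule prob_spaceI) (simp add: em q.cap_space)
    show "sets ?Q = sets M" by simp
  qed (use A in \<open>auto simp: meas q_le qA\<close>)
qed

section \<open>The Choquet integral\<close>

text \<open>For \<open>s < 0\<close> the level set is the whole space and the first integrand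
  vanishes. At \<open>s = 0\<close> it may not vanish, but a single point is a null set.\<close>

lemma choquet_integral_nonneg:
  assumes "capacity (space M) (sets M) c" and nn: "\<And>\<omega>. \<omega> \<in> space M \<Longrightarrow> 0 \<le> X \<omega>"
  shows "choquet_integral M c X = (LBINT s:{0..}. c {\<omega>\<in>space M. X \<omega> > s})"
proof -
  interpret capacity "space M" "sets M" c by fact
  have "c {\<omega>\<in>space M. X \<omega> > s} = 1" if "s < 0" for s
  proof -
    have "{\<omega>\<in>space M. X \<omega> > s} = space M"
      using nn that by force
    then show ?thesis by (simp add: cap_space)
  qed
  then have "AE s in lborel. indicator {..0} s *\<^sub>R (c {\<omega>\<in>space M. X \<omega> > s} - 1) = (0::real)"
    by (intro AE_mp[OF AE_lborel_singleton[of 0] AE_I2]) (auto simp: indicator_def)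
  then have "(LBINT s:{..0}. c {\<omega>\<in>space M. X \<omega> > s} - 1) = 0"
    unfolding set_lebesgue_integral_def by (rule integral_eq_zero_AE)
  then show ?thesis
    by (simp add: choquet_integral_def)
qed

text \<open>As a function of \<open>s\<close> \<ge> 0, the capacity of the level set is
  \<open>c A\<close> on [0,1) and 0 from 1 on, the inequality in the level sets being
  strict.\<close>

lemma choquet_integral_indicator:
  assumes "capacity (space M) (sets M) c" and A: "A \<in> sets M"
  shows "choquet_integral M c (indicator A) = c A"
proof -
  interpret capacity "space M" "sets M" c by fact
  have lt: "{\<omega>\<in>space M. (indicator A \<omega> :: real) > s} = A" if "0 \<le> s" "s < 1" for s
    using that sets.sets_into_space[OF A] by (auto simp: indicator_def split: if_splits)
  have ge: "{\<omega>\<in>space M. (indicator A \<omega> :: real) > s} = {}" if "1 \<le> s" for s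
    using that by (auto simp: indicator_def)
  have "(LBINT s:{0..}. c {\<omega>\<in>space M. (indicator A \<omega> :: real) > s})
      = (LINT s|lborel. indicator {0..<1::real} s *\<^sub>R c A)"
    unfolding set_lebesgue_integral_def
    using lt ge by (intro Bochner_Integration.integral_cong)
      (auto simp: indicator_def cap_empty not_less)
  also have "\<dots> = c A"
    by simp
  finally show ?thesis
    using choquet_integral_nonneg[OF assms(1), of "indicator A"] by simp
qed

section \<open>Sequences of functions decreasing to zero\<close>

lemma decreases_to_zero_nonneg:
  assumes "decreases_to M X (\<lambda>_. 0)" "\<omega> \<in> space M"
  shows "0 \<le> X n \<omega>"
proof -
  have "decseq (\<lambda>n. X n \<omega>)" "(\<lambda>n. X n \<omega>) \<longlonglongrightarrow> 0"
    using assms by (auto simp: decreases_to_def decseq_Suc_iff)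
  then show ?thesis by (rule decseq_ge)
qed

text \<open>Every point eventually leaves the level sets because the limit 0 lies strictly below
  \<open>s\<close>. Positivity of \<open>s\<close> matters: for the constants 1/(n+1) the level sets
  at 0 never shrink.\<close>

lemma level_sets_tendsto_zero:
  assumes cont: "continuous_at_empty (sets M) c"
    and meas: "\<And>n. X n \<in> borel_measurable M"
    and dec: "decreases_to M X (\<lambda>_. 0)" and "0 < s"
  shows "(\<lambda>n. c {\<omega>\<in>space M. X n \<omega> > s}) \<longlonglongrightarrow> 0"
proof (rule cont[unfolded continuous_at_empty_def, rule_format, OF conjI[OF _ conjI]])
  show "\<forall>n. {\<omega>\<in>space M. X n \<omega> > s} \<in> sets M"
    using meas by (auto intro!: borel_measurable_less)
  show "\<forall>n. {\<omega>\<in>space M. X (Suc n) \<omega> > s} \<subseteq> {\<omega>\<in>space M. X n \<omega> > s}"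
    using dec by (auto simp: decreases_to_def intro: less_le_trans)
  have "\<exists>n. X n \<omega> < s" if "\<omega> \<in> space M" for \<omega>
  proof -
    have "(\<lambda>n. X n \<omega>) \<longlonglongrightarrow> 0"
      using dec that by (simp add: decreases_to_def)
    then have "eventually (\<lambda>n. X n \<omega> < s) sequentially"
      using \<open>0 < s\<close> by (rule order_tendstoD)
    then show ?thesis
      by (auto simp: eventually_sequentially)
  qed
  then show "(\<Inter>n. {\<omega>\<in>space M. X n \<omega> > s}) = {}"
    by (auto dest: less_asym)
qed

lemma choquet_integral_tendsto_zero:
  assumes "capacity (space M) (sets M) c" and cont: "continuous_at_empty (sets M) c"
    and bm: "\<And>n. X n \<in> bounded_measurable M" and dec: "decreases_to M X (\<lambda>_. 0)"
  shows "(\<lambda>n. choquet_integral M c (X n)) \<longlonglongrightarrow> 0"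
proof -
  interpret capacity "space M" "sets M" c by fact
  have meas: "X n \<in> borel_measurable M" for n
    using bm by (simp add: bounded_measurable_def)
  have lev: "{\<omega>\<in>space M. X n \<omega> > s} \<in> sets M" for n s
    using meas by (auto intro!: borel_measurable_less)
  obtain K where K: "\<And>\<omega>. \<omega> \<in> space M \<Longrightarrow> \<bar>X 0 \<omega>\<bar> \<le> K"
    using bm[of 0] by (auto simp: bounded_measurable_def)
  \<comment> \<open>A bound of the first function bounds the whole sequence from above, which gives
    one dominating function for all \<open>n\<close>.\<close>
  have le_K: "X n \<omega> \<le> K" if "\<omega> \<in> space M" for n \<omega>
  proof -
    have "decseq (\<lambda>n. X n \<omega>)"
      using dec that by (auto simp: decreases_to_def decseq_Suc_iff)
    then have "X n \<omega> \<le> X 0 \<omega>"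
      by (simp add: decseq_def)
    then show ?thesis
      using K[OF that] by simp
  qed
  let ?f = "\<lambda>n s. indicator {0..} s *\<^sub>R c {\<omega>\<in>space M. X n \<omega> > s}"
  \<comment> \<open>Measurability in \<open>s\<close> comes from monotonicity alone: the level sets
    shrink as \<open>s\<close> grows, so the negated function is increasing.\<close>
  have c_meas: "(\<lambda>s. c {\<omega>\<in>space M. X n \<omega> > s}) \<in> borel_measurable borel" for n
  proof -
    have "mono (\<lambda>s. - c {\<omega>\<in>space M. X n \<omega> > s})"
      by (auto intro!: monoI cap_mono lev)
    then have "(\<lambda>s. - (- c {\<omega>\<in>space M. X n \<omega> > s})) \<in> borel_measurable borel"
      by (intro borel_measurable_uminus borel_measurable_mono)
    then show ?thesis by simp
  qed
  have "(\<lambda>n. LINT s|lborel. ?f n s) \<longlonglongrightarrow> (LINT s::real|lborel. (0::real))"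
  proof (rule integral_dominated_convergence[where w = "indicat_real {0..K}"])
    show "?f n \<in> borel_measurable lborel" for n
      using c_meas[of n] by measurable
    show "integrable lborel (indicator {0..K} :: real \<Rightarrow> real)"
      by (simp add: integrable_indicator_iff emeasure_lborel_Icc_eq)
    \<comment> \<open>At \<open>s = 0\<close> convergence can fail; this null set is
      discarded.\<close>
    have "(\<lambda>n. ?f n s) \<longlonglongrightarrow> 0" if "s \<noteq> 0" for s
      using level_sets_tendsto_zero[OF cont meas dec, of s] that by (cases "s < 0") auto
    then show "AE s in lborel. (\<lambda>n. ?f n s) \<longlonglongrightarrow> 0"
      by (intro AE_mp[OF AE_lborel_singleton[of 0] AE_I2]) simp
    have "norm (?f n s) \<le> indicator {0..K} s" for n s
    proof (cases "s \<le> K")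
      case True
      then show ?thesis
        using cap_nonneg[OF lev[of s n]] cap_le_1[OF lev[of s n]] by (auto simp: indicator_def)
    next
      case False
      then have "{\<omega>\<in>space M. X n \<omega> > s} = {}"
        using le_K[of _ n] by force
      then have "c {\<omega>\<in>space M. X n \<omega> > s} = 0"
        by (simp only: cap_empty)
      then show ?thesis by simp
    qed
    then show "AE s in lborel. norm (?f n s) \<le> indicator {0..K} s" for n
      by simp
  qed simp
  then show ?thesis
    using choquet_integral_nonneg[OF assms(1) decreases_to_zero_nonneg[OF dec]]
    by (simp add: set_lebesgue_integral_def)
qed

section \<open>Default risk measures\<close>

lemma indicator_bounded_measurable: "A \<in> sets M \<Longrightarrow> indicator A \<in> bounded_measurable M"
  by (auto simp: bounded_measurable_def indicator_def intro!: exI[of _ 1])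

lemma decreases_to_indicator:
  assumes "\<And>n. A (Suc n) \<subseteq> A n" "(\<Inter>n. A n) = {}"
  shows "decreases_to M (\<lambda>n. indicator (A n)) (\<lambda>_. 0)"
proof -
  have "decseq A"
    using assms by (simp add: decseq_Suc_iff)
  then have "(\<lambda>n. indicator (A n) \<omega> :: real) \<longlonglongrightarrow> indicator (\<Inter>n. A n) \<omega>" for \<omega>
    by (rule LIMSEQ_indicator_decseq)
  then show ?thesis
    using assms by (auto simp: decreases_to_def indicator_def)
qed

lemma capacity_of_default_risk_measure:
  assumes "default_risk_measure M \<rho>" and c: "\<And>A. A \<in> sets M \<Longrightarrow> c A = \<rho> (indicator A)"
  shows "capacity (space M) (sets M) c"
proof
  have drm: "\<rho> (\<lambda>_. 0) = 0" "\<rho> (\<lambda>_. 1) = 1"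
    and mono: "\<And>X Y. \<lbrakk>X \<in> bounded_measurable M; Y \<in> bounded_measurable M;
      \<forall>\<omega>\<in>space M. X \<omega> \<le> Y \<omega>\<rbrakk> \<Longrightarrow> \<rho> X \<le> \<rho> Y"
    using assms(1) by (auto simp: default_risk_measure_def)
  show "c {} = 0"
    using c[of "{}"] drm by (simp add: indicator_def[abs_def])
  have "(\<lambda>_. 1) \<in> bounded_measurable M"
    by (auto simp: bounded_measurable_def)
  \<comment> \<open>The two functions may differ outside \<open>space M\<close>; monotonicity, used
    in both directions, only sees \<open>space M\<close>.\<close>
  then have "\<rho> (indicator (space M)) = \<rho> (\<lambda>_. 1)"
    by (intro antisym mono) (auto intro: indicator_bounded_measurable)
  then show "c (space M) = 1"
    using c[of "space M"] drm by simp
  show "c A \<le> c B" if "A \<in> sets M" "B \<in> sets M" "A \<subseteq> B" for A B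
    using that by (auto simp: c indicator_def intro!: mono indicator_bounded_measurable)
qed

lemma submodular_capacity_of_default_risk_measure:
  assumes "default_risk_measure M \<rho>" "submodular_risk M \<rho>"
    and c: "\<And>A. A \<in> sets M \<Longrightarrow> c A = \<rho> (indicator A)"
  shows "submodular_capacity (space M) (sets M) c"
proof -
  interpret capacity "space M" "sets M" c
    by (rule capacity_of_default_risk_measure[OF assms(1) c])
  show ?thesis
  proof
    fix A B assume AB: "A \<in> sets M" "B \<in> sets M"
    have "(\<lambda>\<omega>. min (indicator A \<omega>) (indicator B \<omega>) :: real) = indicator (A \<inter> B)"
      "(\<lambda>\<omega>. max (indicator A \<omega>) (indicator B \<omega>) :: real) = indicator (A \<union> B)"
      by (auto simp: indicator_def)
    then show "c (A \<inter> B) + c (A \<union> B) \<le> c A + c B"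
      using assms(2) AB indicator_bounded_measurable[of A M] indicator_bounded_measurable[of B M]
      unfolding submodular_risk_def by (metis c sets.Int sets.Un)
  qed
qed

text \<open>Instead of a cycle of implications, each of the three conditions is compared with
  continuity of \<open>c\<close> at the empty set. The maximum over \<open>\<P>\<close> is expressed
  as attainment together with an upper bound.\<close>

theorem proposition42:
  fixes M :: "'a measure"
    and \<rho> :: "('a \<Rightarrow> real) \<Rightarrow> real"
    and c :: "'a set \<Rightarrow> real"
  assumes "space M \<noteq> {}"
    and "default_risk_measure M \<rho>"
    and "\<And>X. X \<in> bounded_measurable M \<Longrightarrow> \<rho> X = \<rho> (indicator {\<omega>\<in>space M. X \<omega> > 0})"
    and "\<And>A. A \<in> sets M \<Longrightarrow> c A = \<rho> (indicator A)"
  shows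
    "let cond_i =
           (\<forall>X. (\<forall>n::nat. X n \<in> bounded_measurable M) \<and> decreases_to M X (\<lambda>_. 0) \<longrightarrow>
             (\<forall>\<epsilon>>0. (\<lambda>n. \<rho> (\<lambda>\<omega>. X n \<omega> - \<epsilon>)) \<longlonglongrightarrow> 0));
         cond_ii =
           (\<forall>A. (\<forall>n::nat. A n \<in> sets M) \<and> (\<forall>n. A (Suc n) \<subseteq> A n) \<and> (\<Inter>n. A n) = {} \<longrightarrow>
             (\<lambda>n. \<rho> (indicator (A n))) \<longlonglongrightarrow> 0);
         cond_iii =
           (\<forall>X. (\<forall>n::nat. X n \<in> bounded_measurable M) \<and> decreases_to M X (\<lambda>_. 0) \<longrightarrow>
             (\<lambda>n. choquet_integral M c (X n)) \<longlonglongrightarrow> 0)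
     in (cond_i \<longleftrightarrow> cond_ii) \<and> (cond_ii \<longleftrightarrow> cond_iii) \<and>
        (submodular_risk M \<rho> \<and> (cond_i \<or> cond_ii \<or> cond_iii) \<longrightarrow>
          (\<exists>\<P>. \<P> \<noteq> {} \<and> (\<forall>Q\<in>\<P>. prob_space Q \<and> sets Q = sets M) \<and>
            (\<forall>X\<in>bounded_measurable M.
              (\<exists>Q\<in>\<P>. \<rho> X = measure Q {\<omega>\<in>space M. X \<omega> > 0}) \<and>
              (\<forall>Q\<in>\<P>. measure Q {\<omega>\<in>space M. X \<omega> > 0} \<le> \<rho> X))))"
proof -
  note c = assms(4)
  have cap: "capacity (space M) (sets M) c"
    by (rule capacity_of_default_risk_measure[OF assms(2) c])
  have lev: "{\<omega>\<in>space M. X \<omega> > s} \<in> sets M" if "X \<in> bounded_measurable M" for X s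
    using that by (auto simp: bounded_measurable_def intro!: borel_measurable_less)
  \<comment> \<open>Subtracting \<open>s\<close> turns the level 0 in the assumption on
    \<open>\<rho>\<close> into an arbitrary level: \<open>s = \<epsilon>\<close> serves condition
    (i), \<open>s = 0\<close> the representation.\<close>
  have shift: "\<rho> (\<lambda>\<omega>. X \<omega> - s) = c {\<omega>\<in>space M. X \<omega> > s}" if X: "X \<in> bounded_measurable M" for X s
  proof -
    obtain C where C: "\<And>\<omega>. \<omega> \<in> space M \<Longrightarrow> \<bar>X \<omega>\<bar> \<le> C"
      using X by (auto simp: bounded_measurable_def)
    then have "\<forall>\<omega>\<in>space M. \<bar>X \<omega> - s\<bar> \<le> C + \<bar>s\<bar>"
      by force
    then have "(\<lambda>\<omega>. X \<omega> - s) \<in> bounded_measurable M"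
      using X by (auto simp: bounded_measurable_def)
    then show ?thesis
      using assms(3) c[OF lev[OF X]] by simp
  qed
  define cond_i where "cond_i \<longleftrightarrow>
    (\<forall>X. (\<forall>n::nat. X n \<in> bounded_measurable M) \<and> decreases_to M X (\<lambda>_. 0) \<longrightarrow>
      (\<forall>\<epsilon>>0. (\<lambda>n. \<rho> (\<lambda>\<omega>. X n \<omega> - \<epsilon>)) \<longlonglongrightarrow> 0))"
  define cond_ii where "cond_ii \<longleftrightarrow>
    (\<forall>A. (\<forall>n::nat. A n \<in> sets M) \<and> (\<forall>n. A (Suc n) \<subseteq> A n) \<and> (\<Inter>n. A n) = {} \<longrightarrow>
      (\<lambda>n. \<rho> (indicator (A n))) \<longlonglongrightarrow> 0)"
  define cond_iii where "cond_iii \<longleftrightarrow>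
    (\<forall>X. (\<forall>n::nat. X n \<in> bounded_measurable M) \<and> decreases_to M X (\<lambda>_. 0) \<longrightarrow>
      (\<lambda>n. choquet_integral M c (X n)) \<longlonglongrightarrow> 0)"
  have ii: "cond_ii \<longleftrightarrow> continuous_at_empty (sets M) c"
    unfolding cond_ii_def continuous_at_empty_def
    by (intro arg_cong[where f = All] ext imp_cong refl) (simp add: c)
  have "cond_i" if "continuous_at_empty (sets M) c"
    unfolding cond_i_def
  proof (intro allI impI)
    fix X :: "nat \<Rightarrow> 'a \<Rightarrow> real" and \<epsilon> :: real
    assume "(\<forall>n. X n \<in> bounded_measurable M) \<and> decreases_to M X (\<lambda>_. 0)" "0 < \<epsilon>"
    then show "(\<lambda>n. \<rho> (\<lambda>\<omega>. X n \<omega> - \<epsilon>)) \<longlonglongrightarrow> 0"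
      using level_sets_tendsto_zero[OF that, of X \<epsilon>] by (simp add: shift bounded_measurable_def)
  qed
  moreover have "cond_iii" if "continuous_at_empty (sets M) c"
    unfolding cond_iii_def using choquet_integral_tendsto_zero[OF cap that] by simp
  moreover have "continuous_at_empty (sets M) c" if "cond_i \<or> cond_iii"
    unfolding continuous_at_empty_def
  proof (intro allI impI, elim conjE)
    fix A :: "nat \<Rightarrow> 'a set"
    assume A: "\<forall>n. A n \<in> sets M" "\<forall>n. A (Suc n) \<subseteq> A n" "(\<Inter>n. A n) = {}"
    let ?X = "\<lambda>n. indicator (A n) :: 'a \<Rightarrow> real"
    have X: "\<forall>n. ?X n \<in> bounded_measurable M" "decreases_to M ?X (\<lambda>_. 0)"
      using A by (auto intro: indicator_bounded_measurable decreases_to_indicator)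
    \<comment> \<open>The choice \<epsilon> = 1/2 is arbitrary: every level strictly between 0 and 1
      recovers \<open>A n\<close> from its indicator.\<close>
    have "{\<omega>\<in>space M. ?X n \<omega> > 1/2} = A n" for n
      using A sets.sets_into_space[of "A n" M] by (auto simp: indicator_def split: if_splits)
    then have "\<rho> (\<lambda>\<omega>. ?X n \<omega> - 1/2) = c (A n)" for n
      using shift[of "?X n" "1/2"] X by simp
    moreover have "choquet_integral M c (?X n) = c (A n)" for n
      using A choquet_integral_indicator[OF cap] by simp
    ultimately show "(\<lambda>n. c (A n)) \<longlonglongrightarrow> 0"
      using that
    proof (elim disjE)
      assume "cond_i"
      then have "(\<lambda>n. \<rho> (\<lambda>\<omega>. ?X n \<omega> - 1/2)) \<longlonglongrightarrow> 0"
        using X unfolding cond_i_def by (elim allE[of _ ?X]) simp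
      then show ?thesis
        using \<open>\<And>n. \<rho> (\<lambda>\<omega>. ?X n \<omega> - 1/2) = c (A n)\<close> by simp
    next
      assume "cond_iii"
      then have "(\<lambda>n. choquet_integral M c (?X n)) \<longlonglongrightarrow> 0"
        using X unfolding cond_iii_def by (elim allE[of _ ?X]) simp
      then show ?thesis
        using \<open>\<And>n. choquet_integral M c (?X n) = c (A n)\<close> by simp
    qed
  qed
  moreover have "\<exists>\<P>. \<P> \<noteq> {} \<and> (\<forall>Q\<in>\<P>. prob_space Q \<and> sets Q = sets M) \<and>
      (\<forall>X\<in>bounded_measurable M.
        (\<exists>Q\<in>\<P>. \<rho> X = measure Q {\<omega>\<in>space M. X \<omega> > 0}) \<and>
        (\<forall>Q\<in>\<P>. measure Q {\<omega>\<in>space M. X \<omega> > 0} \<le> \<rho> X))"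
    if "submodular_risk M \<rho>" "continuous_at_empty (sets M) c"
  proof -
    have sub: "submodular_capacity (space M) (sets M) c"
      by (rule submodular_capacity_of_default_risk_measure[OF assms(2) that(1) c])
    \<comment> \<open>This is the countably additive core of \<open>c\<close>. Taking all dominated
      probability measures makes the upper bound immediate and leaves only attainment, one set at a
      time.\<close>
    define \<P> where "\<P> = {Q. prob_space Q \<and> sets Q = sets M \<and> (\<forall>B\<in>sets M. measure Q B \<le> c B)}"
    have ex: "\<exists>Q\<in>\<P>. measure Q A = c A" if "A \<in> sets M" for A
    proof (rule ex_prob_space_below[OF sub \<open>continuous_at_empty (sets M) c\<close> that])
      fix Q assume "prob_space Q" "sets Q = sets M" "\<And>B. B \<in> sets M \<Longrightarrow> measure Q B \<le> c B"
        and eq: "measure Q A = c A"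
      then have "Q \<in> \<P>"
        by (simp add: \<P>_def)
      with eq show ?thesis
        by blast
    qed
    have \<rho>: "\<rho> X = c {\<omega>\<in>space M. X \<omega> > 0}" if "X \<in> bounded_measurable M" for X
      using shift[OF that, of 0] by simp
    show ?thesis
    proof (intro exI[of _ \<P>] conjI ballI)
      show "\<P> \<noteq> {}"
        using ex[of "{}"] by auto
      show "\<exists>Q\<in>\<P>. \<rho> X = measure Q {\<omega>\<in>space M. X \<omega> > 0}" if "X \<in> bounded_measurable M" for X
        using ex[OF lev[OF that, of 0]] \<rho>[OF that] by metis
      show "measure Q {\<omega>\<in>space M. X \<omega> > 0} \<le> \<rho> X" if "X \<in> bounded_measurable M" "Q \<in> \<P>" for X Q
        using that lev[OF that(1), of 0] \<rho>[OF that(1)] by (simp add: \<P>_def)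
    qed (auto simp: \<P>_def)
  qed
  ultimately show ?thesis
    unfolding Let_def cond_i_def[symmetric] cond_ii_def[symmetric] cond_iii_def[symmetric] ii
    by blast
qed

end
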